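(* For every odd prime $p>2$, \[ \sum_{k=0}^{\frac{p-1}{2}}\frac{11k+3}{64^{k}}\binom{2k}{k}^2\binom{3k}{k} \equiv 3p+3p^2q_p(2) \pmod{p^3}. \]
   Context: For an odd prime $p$, the Fermat quotient is $q_p(2)=\frac{2^{p-1}-1}{p}$. Congruences between rational numbers whose denominators are coprime to $p$ are understood in the ring of $p$-integral rationals. *)

theory Defs
  imports Complex_Main "HOL-Computational_Algebra.Primes"
begin

definition fermat_quotient2 :: "nat \<Rightarrow> rat" where
  "fermat_quotient2 p = (2 ^ (p - 1) - 1) / of_nat p"

text \<open>Congruence of rationals modulo p^n in the ring of p-integral rationals:
  a = b (mod p^n) iff (a - b)/p^n has (reduced) denominator coprime to p.\<close>
definition rat_cong_pow :: "rat \<Rightarrow> rat \<Rightarrow> nat \<Rightarrow> nat \<Rightarrow> bool" where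
  "rat_cong_pow a b p n \<longleftrightarrow>
     coprime (snd (quotient_of ((a - b) / of_nat p ^ n))) (int p)"

end

theory Submission
  imports Defs "HOL-Number_Theory.Cong"
begin

text \<open>
  Write \<open>p = 2 m + 1\<close>. Wilf--Zeilberger theory for Dougall's well-poised sum converts the truncated sum
  exactly into \<open>3 p C(2m, m) / 16 ^ m\<close> times \<open>\<Sum>i\<le>m. C(2i, i) C(p + i, m) / 4 ^ i\<close>.
  Since \<open>3 p + 3 p\<^sup>2 q\<^sub>p(2) = 3 p 4 ^ m\<close>, it remains to treat the new sum modulo \<open>p\<^sup>2\<close>. Its terms with
  \<open>i < m\<close> are divisible by \<open>p\<close> and become \<open>- p / (m - i)\<close> after multiplication by \<open>C(2m, m)\<close>,
  because \<open>C(p + i, m) C(m, i) = C(p + i, i) C(p, m - i)\<close> and \<open>C(2i, i) \<equiv> (-4) ^ i C(m, i)\<close>.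
  Everything is thereby expressed by the harmonic number \<open>H\<close> of index \<open>m\<close>, and
  \<open>2 \<cdot> 4 ^ m \<equiv> 2 - p H\<close>, twice the sum of the even-indexed \<open>C(p, k)\<close>, eliminates it.
\<close>

section \<open>Exact transformation of the truncated sum by a WZ pair\<close>

definition summand :: "nat \<Rightarrow> rat" where
  "summand n = (11 * of_nat n + 3) / 64 ^ n * of_nat ((2 * n choose n) ^ 2 * (3 * n choose n))"

text \<open>The prime is replaced by \<open>2 * m + 1\<close> with arbitrary \<open>m\<close>, so
  that induction on \<open>m\<close> is possible; primality enters only with the
  congruences.\<close>

definition dual_summand :: "nat \<Rightarrow> nat \<Rightarrow> rat" where
  "dual_summand m i = 3 * of_nat (2 * m + 1) * of_nat (2 * m choose m) / 16 ^ m *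
     (of_nat (2 * i choose i) / 4 ^ i) * of_nat ((2 * m + 1 + i) choose m)"

lemma dual_summand_fact:
  "dual_summand m i = 3 * fact (2 * m + 1) / (fact m ^ 2 * 16 ^ m) * (fact (2 * i) / (fact i ^ 2 * 4 ^ i))
     * (fact (2 * m + 1 + i) / (fact m * fact (m + 1 + i)))"
proof -
  have 1: "of_nat (2 * n choose n) = (fact (2 * n) / fact n ^ 2 :: rat)" for n
    by (simp add: binomial_fact power2_eq_square)
  have 2: "of_nat ((2 * m + 1 + i) choose m) = (fact (2 * m + 1 + i) / (fact m * fact (m + 1 + i)) :: rat)"
    by (subst binomial_fact) auto
  show ?thesis
    unfolding dual_summand_def 1 2 by (simp add: field_simps)
qed

text \<open>The ratio of consecutive terms in \<open>m\<close>, and below in \<open>i\<close>, is a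
  rational function; both are stated with denominators cleared.\<close>

lemma dual_summand_Suc_left:
  "8 * of_nat (m + 1) ^ 2 * of_nat (m + 2 + i) * dual_summand (Suc m) i =
     of_nat (2 * m + 3) * of_nat (2 * m + 2 + i) * of_nat (2 * m + 3 + i) * dual_summand m i"
proof -
  have 1: "fact (2 * Suc m + 1) = (of_nat (2*m+3) * of_nat (2*m+2) * fact (2*m+1) :: rat)"
    by (simp add: algebra_simps numeral_eq_Suc)
  have 2: "fact (2 * Suc m + 1 + i) = (of_nat (2*m+3+i) * of_nat (2*m+2+i) * fact (2*m+1+i) :: rat)"
    by (simp add: algebra_simps numeral_eq_Suc)
  have 3: "fact (Suc m + 1 + i) = (of_nat (m+2+i) * fact (m+1+i) :: rat)"
    by (simp add: algebra_simps)
  have 4: "fact (Suc m) = (of_nat (m+1) * fact m :: rat)"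
    by (simp add: algebra_simps)
  \<comment> \<open>Each linear factor and each factorial becomes a free variable (\<open>a\<close>
    is m + 1, \<open>b\<close> is m + 2 + i, \<open>c\<close> is 2m + 3), so that only cancellation
    in a field remains.\<close>
  have alg: "8 * a^2 * b * (3 * (c * (2 * a) * F) / ((a * f)^2 * (16 * x)) * g * (d * e * h / (a * f * (b * k)))) =
      c * e * d * (3 * F / (f^2 * x) * g * (h / (f * k)))"
    if "a \<noteq> 0" "b \<noteq> 0" "f \<noteq> 0" "x \<noteq> 0" "k \<noteq> 0" for a b c d e F f x g h k :: rat
    using that by (simp add: field_simps power2_eq_square)
  have 5: "of_nat (2*m+2) = (2 * of_nat (m + 1) :: rat)" by simp
  show ?thesis
    unfolding dual_summand_fact 1 2 3 4 5 power_Suc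
    by (rule alg) (auto simp del: of_nat_Suc of_nat_add)
qed

lemma dual_summand_Suc_right:
  "2 * of_nat (i + 1) * of_nat (m + 2 + i) * dual_summand m (Suc i) =
     of_nat (2 * i + 1) * of_nat (2 * m + 2 + i) * dual_summand m i"
proof -
  have 1: "fact (2 * Suc i) = (2 * of_nat (i+1) * of_nat (2*i+1) * fact (2*i) :: rat)"
    by (simp add: algebra_simps numeral_eq_Suc)
  have 2: "fact (2 * m + 1 + Suc i) = (of_nat (2*m+2+i) * fact (2*m+1+i) :: rat)"
    by (simp add: algebra_simps numeral_eq_Suc)
  have 3: "fact (m + 1 + Suc i) = (of_nat (m+2+i) * fact (m+1+i) :: rat)"
    by (simp add: algebra_simps)
  have 4: "fact (Suc i) = (of_nat (i+1) * fact i :: rat)"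
    by (simp add: algebra_simps)
  have alg: "2 * a * b * (g * (2 * a * c * F / ((a * f)^2 * (4 * x))) * (e * h / (k * (b * l)))) =
      c * e * (g * (F / (f^2 * x)) * (h / (k * l)))"
    if "a \<noteq> 0" "b \<noteq> 0" "f \<noteq> 0" "x \<noteq> 0" "k \<noteq> 0" "l \<noteq> 0" for a b c e F f x g h k l :: rat
    using that by (simp add: field_simps power2_eq_square)
  show ?thesis
    unfolding dual_summand_fact 1 2 3 4 power_Suc
    by (rule alg) (auto simp del: of_nat_Suc of_nat_add)
qed

text \<open>The certificate that Gosper's algorithm returns for the difference of \<open>dual_summand\<close> in \<open>m\<close>.\<close>

definition cert :: "nat \<Rightarrow> nat \<Rightarrow> rat" where
  "cert m i = dual_summand m i * of_nat i ^ 2 / (4 * of_nat (m + 1) ^ 2)"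

text \<open>This is the WZ equation. Each shift multiplies \<open>dual_summand m i\<close> by a
  rational function of m and i, so taking this term out as a common factor leaves an identity
  between rational functions.\<close>

lemma dual_summand_telescope:
  "dual_summand (Suc m) i - dual_summand m i = cert m (Suc i) - cert m i"
proof -
  define M I where "M = (of_nat m :: rat)" and "I = (of_nat i :: rat)"
  have pos: "M + 1 \<noteq> 0" "M + 2 + I \<noteq> 0" "I + 1 \<noteq> 0"
    unfolding M_def I_def by (simp_all add: add_nonneg_eq_0_iff)
  have 1: "dual_summand (Suc m) i = (2*M+3) * (2*M+2+I) * (2*M+3+I) / (8 * (M+1)^2 * (M+2+I)) * dual_summand m i"
  proof -
    have "8 * (M+1)^2 * (M+2+I) * dual_summand (Suc m) i =
        (2*M+3) * (2*M+2+I) * (2*M+3+I) * dual_summand m i"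
      using dual_summand_Suc_left[of m i] by (simp add: M_def I_def ac_simps)
    with pos show ?thesis by (simp add: eq_divide_eq mult.commute)
  qed
  have 2: "dual_summand m (Suc i) = (2*I+1) * (2*M+2+I) / (2 * (I+1) * (M+2+I)) * dual_summand m i"
  proof -
    have "2 * (I+1) * (M+2+I) * dual_summand m (Suc i) = (2*I+1) * (2*M+2+I) * dual_summand m i"
      using dual_summand_Suc_right[of i m] by (simp add: M_def I_def ac_simps)
    with pos show ?thesis by (simp add: eq_divide_eq mult.commute)
  qed
  have 3: "cert m (Suc i) = (2*I+1) * (2*M+2+I) / (2 * (I+1) * (M+2+I)) * dual_summand m i * (I+1)^2 / (4 * (M+1)^2)"
    unfolding cert_def 2 by (simp add: M_def I_def algebra_simps)
  have 4: "cert m i = dual_summand m i * I^2 / (4 * (M+1)^2)"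
    unfolding cert_def by (simp add: M_def I_def algebra_simps)
  have "(2*M+3) * (2*M+2+I) * (2*M+3+I) / (8 * (M+1)^2 * (M+2+I)) - 1 =
    (2*I+1) * (2*M+2+I) / (2 * (I+1) * (M+2+I)) * (I+1)^2 / (4 * (M+1)^2) - I^2 / (4 * (M+1)^2)"
    using pos by (simp add: divide_simps) algebra
  then show ?thesis unfolding 1 3 4 by (simp add: algebra_simps) algebra
qed

text \<open>The right-hand side is what the dual sum gains from \<open>m\<close> to
  \<open>Suc m\<close>: the new diagonal term and the telescoped boundary. With n = m + 1, they
  contribute 9n + 3 and 2n to the linear factor 11n + 3.\<close>

lemma summand_Suc: "summand (Suc m) = dual_summand (Suc m) (Suc m) + cert m (Suc m)"
proof -
  define n where "n = Suc m"
  have nz: "(of_nat n :: rat) \<noteq> 0" "2 * (of_nat n :: rat) + 1 \<noteq> 0"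
    by (simp_all add: n_def add_nonneg_eq_0_iff)
  define C where "C = (fact (2 * n) / fact n ^ 2 :: rat)"
  define D where "D = (fact (3 * n) / (fact n * fact (2 * n)) :: rat)"
  have C: "of_nat (2 * n choose n) = C"
    by (simp add: binomial_fact power2_eq_square C_def)
  have D: "of_nat (3 * n choose n) = D"
    by (subst binomial_fact) (auto simp: D_def)
  have E: "of_nat ((2 * n + 1 + n) choose n) = (3 * of_nat n + 1) / (2 * of_nat n + 1) * D"
  proof -
    have e: "2 * n + 1 + n = Suc (3 * n)" "Suc (3*n) - n = Suc (2 * n)" by auto
    show ?thesis unfolding e(1)
      by (subst binomial_fact) (use nz in \<open>auto simp: D_def e Suc_diff_le field_simps\<close>)
  qed
  have F: "of_nat (2 * m + 1) * of_nat (2 * m choose m) = of_nat n * C / 2"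
  proof -
    have "fact (2 * n) = (2 * of_nat n * of_nat (2*m+1) * fact (2*m) :: rat)"
      unfolding n_def by (simp add: algebra_simps numeral_eq_Suc)
    moreover have "fact n = (of_nat n * fact m :: rat)" unfolding n_def by simp
    ultimately show ?thesis using nz
      by (simp add: binomial_fact power2_eq_square C_def field_simps)
  qed
  \<comment> \<open>Since 2m + 1 + n = 3n - 1 and m = n - 1, absorption yields one third of C(3n,
    n).\<close>
  have G: "of_nat ((2 * m + 1 + n) choose m) = D / 3"
  proof -
    have "n * (3 * n choose n) = 3 * n * ((2 * m + 1 + n) choose m)"
      using Suc_times_binomial[of m "2*m+1+n"] unfolding n_def by (simp add: algebra_simps numeral_eq_Suc)
    then have "of_nat n * D = 3 * of_nat n * (of_nat ((2 * m + 1 + n) choose m) :: rat)"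
      unfolding D[symmetric] of_nat_mult[symmetric] by (metis of_nat_mult of_nat_numeral)
    then show ?thesis using nz by simp
  qed
  have 1: "summand n = (11 * of_nat n + 3) / 64 ^ n * (C^2 * D)"
    unfolding summand_def of_nat_mult of_nat_power C D ..
  have x: "(64::rat) ^ n = 16 ^ n * 4 ^ n" by (simp flip: power_mult_distrib)
  have alg: "3 * e * C / y * (C / z) * (r / e * D) = 3 * r / (y * z) * (C^2 * D)"
    if "e \<noteq> 0" for e r y z :: rat
    using that by (simp add: power2_eq_square)
  have 2: "dual_summand n n = (9 * of_nat n + 3) / 64 ^ n * (C^2 * D)"
  proof -
    have "dual_summand n n = 3 * (2 * of_nat n + 1) * C / 16 ^ n * (C / 4 ^ n) *
        ((3 * of_nat n + 1) / (2 * of_nat n + 1) * D)"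
      unfolding dual_summand_def C E by simp
    also have "\<dots> = 3 * (3 * of_nat n + 1) / (16 ^ n * 4 ^ n) * (C^2 * D)"
      by (rule alg) (use nz in auto)
    finally show ?thesis by (simp add: x)
  qed
  have 3: "dual_summand m n = 8 * of_nat n / 64 ^ n * (C^2 * D)"
  proof -
    have "dual_summand m n = 3 * (of_nat n * C / 2) / 16 ^ m * (C / 4 ^ n) * (D / 3)"
      unfolding dual_summand_def C F[symmetric] G by (simp only: mult.assoc)
    also have "\<dots> = 8 * of_nat n / 64 ^ n * (C^2 * D)"
      unfolding x by (simp add: n_def power2_eq_square divide_simps)
    finally show ?thesis .
  qed
  have 4: "cert m n = 2 * of_nat n / 64 ^ n * (C^2 * D)"
  proof -
    have "of_nat (m + 1) = (of_nat n :: rat)" by (simp add: n_def)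
    then show ?thesis unfolding cert_def 3 using nz by simp
  qed
  show ?thesis
    unfolding n_def[symmetric] 1 2 4 by (simp add: field_simps)
qed

text \<open>Induction on \<open>m\<close>: the old dual terms change by a telescoping sum, whose
  lower end vanishes because \<open>cert\<close> has the factor i^2; \<open>summand_Suc\<close>
  accounts for the rest.\<close>

lemma sum_summand: "(\<Sum>n = 0..m. summand n) = (\<Sum>i = 0..m. dual_summand m i)"
proof (induction m)
  case 0
  show ?case by (simp add: summand_def dual_summand_def)
next
  case (Suc m)
  have "(\<Sum>i = 0..m. dual_summand (Suc m) i - dual_summand m i) = (\<Sum>i = 0..m. cert m (Suc i) - cert m i)"
    by (simp only: dual_summand_telescope)
  also have "\<dots> = cert m (Suc m) - cert m 0"
    by (rule sum_Suc_diff) simp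
  also have "\<dots> = cert m (Suc m)" by (simp add: cert_def)
  finally show ?case using Suc.IH by (simp add: summand_Suc sum_subtractf)
qed


section \<open>Binomial coefficients modulo p, and first lifts to p^2\<close>

text \<open>The lifting device used throughout: next to a factor divisible by p, the cofactor
  matters only modulo p.\<close>

lemma cong_mult_square_modulus:
  fixes x y z p :: int
  assumes "[x = y] (mod p)" "p dvd z"
  shows "[x * z = y * z] (mod p ^ 2)"
proof -
  have "p * p dvd (x - y) * z"
    using assms by (intro mult_dvd_mono) (auto simp: cong_iff_dvd_diff)
  then show ?thesis
    by (simp add: cong_iff_dvd_diff power2_eq_square left_diff_distrib)
qed

lemma prime_not_dvd_choose:
  assumes "prime (p :: nat)" "m < p" "i \<le> m"
  shows "\<not> p dvd (m choose i)"
proof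
  assume "p dvd (m choose i)"
  then have "p dvd fact i * fact (m - i) * (m choose i)" by simp
  then have "p dvd fact m" using binomial_fact_lemma[OF assms(3)] by simp
  then show False using assms by (simp add: prime_dvd_fact_iff)
qed

text \<open>By Pascal's rule neighbours in row p - 1 add up to an entry of row p, which p divides,
  so the sign alternates.\<close>

lemma choose_pred_prime_cong:
  assumes "prime (p :: nat)" "k < p"
  shows "[int (p - 1 choose k) = (- 1) ^ k] (mod int p)"
  using assms(2)
proof (induction k)
  case 0
  show ?case by simp
next
  case (Suc k)
  have "p = Suc (p - 1)" using prime_gt_0_nat[OF assms(1)] by simp
  then have "int (p - 1 choose Suc k) = int (p choose Suc k) - int (p - 1 choose k)"
    by (metis add_diff_cancel_left' binomial_Suc_Suc of_nat_add)
  moreover have "int p dvd int (p choose Suc k)"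
    using dvd_choose_prime[of "Suc k" p] assms(1) Suc.prems by simp
  then have "[int (p choose Suc k) = 0] (mod int p)" by (simp add: cong_0_iff)
  ultimately show ?case using cong_diff[of _ 0 "int p", OF _ Suc.IH] Suc.prems by simp
qed

text \<open>Absorption turns the left side into p C(p - 1, k), and the factor p lifts the preceding
  congruence.\<close>

lemma times_choose_prime_cong:
  assumes "prime (p :: nat)" "k < p"
  shows "[int (Suc k) * int (p choose Suc k) = int p * (- 1) ^ k] (mod int p ^ 2)"
proof -
  have "Suc k * (p choose Suc k) = p * (p - 1 choose k)"
    using times_binomial_minus1_eq[of "Suc k" p] by simp
  then have "int (Suc k) * int (p choose Suc k) = int (p - 1 choose k) * int p"
    by (metis of_nat_mult mult.commute)
  then show ?thesis
    using cong_mult_square_modulus[OF choose_pred_prime_cong[OF assms], of "int p"]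
    by (simp add: mult.commute)
qed

text \<open>Modulo p the number m is -1/2, and C(2i, i) = (-4)^i C(-1/2, i). The induction compares
  the ratios of consecutive terms.\<close>

lemma central_binomial_cong:
  assumes "prime p" "p = 2 * m + 1" "i \<le> m"
  shows "[int (2 * i choose i) = (- 4) ^ i * int (m choose i)] (mod int p)"
  using assms(3)
proof (induction i)
  case 0
  show ?case by simp
next
  case (Suc i)
  have 1: "int (Suc i) * int (2 * Suc i choose Suc i) = 2 * (2 * int i + 1) * int (2 * i choose i)"
  proof -
    have "Suc i * (2 * Suc i choose Suc i) = (2 * i + 2) * (Suc (2 * i) choose i)"
      using Suc_times_binomial[of i "Suc (2 * i)"] by simp
    moreover have "Suc i * (Suc (2 * i) choose i) = (2 * i + 1) * (2 * i choose i)"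
      using binomial_absorb_comp[of "Suc (2*i)" i] by (simp add: Suc_diff_le)
    ultimately have "Suc i * (2 * Suc i choose Suc i) = 2 * ((2 * i + 1) * (2 * i choose i))"
      by (simp add: algebra_simps)
    then have "int (Suc i * (2 * Suc i choose Suc i)) = int (2 * ((2 * i + 1) * (2 * i choose i)))"
      by (rule arg_cong)
    then show ?thesis
      by (simp only: of_nat_mult of_nat_add of_nat_numeral of_nat_1 mult.assoc)
  qed
  have 2: "int (Suc i) * int (m choose Suc i) = (int m - int i) * int (m choose i)"
  proof -
    have "Suc i * (m choose Suc i) = (m - i) * (m choose i)"
      by (metis binomial_absorb_comp binomial_absorption)
    then show ?thesis using Suc.prems by (metis Suc_leD of_nat_diff of_nat_mult)
  qed
  \<comment> \<open>The difference of the two sides is 4m + 2 = 2p, hence the witness 2.\<close>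
  have "[2 * (2 * int i + 1) = - 4 * (int m - int i)] (mod int p)"
    unfolding cong_iff_dvd_diff by (rule dvdI[of _ _ 2]) (simp add: assms(2))
  then have step: "[2 * (2 * int i + 1) * int (2 * i choose i) =
      (- 4 * (int m - int i)) * ((- 4) ^ i * int (m choose i))] (mod int p)"
    by (rule cong_mult) (use Suc in simp)
  have "[int (Suc i) * int (2 * Suc i choose Suc i) =
      int (Suc i) * ((- 4) ^ Suc i * int (m choose Suc i))] (mod int p)"
  proof -
    have "int (Suc i) * ((- 4) ^ Suc i * int (m choose Suc i)) =
        (- 4) ^ Suc i * ((int m - int i) * int (m choose i))"
      unfolding 2[symmetric] by (simp only: ac_simps)
    with step show ?thesis unfolding 1 by (simp only: power_Suc ac_simps)
  qed
  moreover have "coprime (Suc i) p"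
    using assms(1,2) Suc.prems prime_imp_coprime[of p "Suc i"] nat_dvd_not_less[of "Suc i" p]
    by (simp add: coprime_commute)
  then have "coprime (int (Suc i)) (int p)" by (simp only: coprime_int_iff)
  ultimately show ?case by (simp only: cong_mult_lcancel)
qed

text \<open>The function \<open>v\<close> plays the role of \<open>j \<mapsto> 1 / j\<close>, so that \<open>\<Sum>j = 1..m. v j\<close>
  is the harmonic number of index \<open>m\<close>.\<close>

locale prime_square_inverses =
  fixes p m :: nat and v :: "nat \<Rightarrow> int"
  assumes prime_p: "prime p" and p_eq: "p = 2 * m + 1"
    and inverse: "0 < j \<Longrightarrow> j < p \<Longrightarrow> [int j * v j = 1] (mod int p ^ 2)"
begin

section \<open>Expansions modulo p^2 in terms of harmonic numbers\<close>

lemma cong_inverse: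
  assumes "0 < j" "j < p" "[int j * x = y] (mod int p ^ 2)"
  shows "[x = v j * y] (mod int p ^ 2)"
proof -
  have "[v j * (int j * x) = v j * y] (mod int p ^ 2)"
    using assms(3) by (rule cong_scalar_left)
  moreover have "[(int j * v j) * x = 1 * x] (mod int p ^ 2)"
    using inverse[OF assms(1,2)] by (rule cong_scalar_right)
  ultimately show ?thesis
    by (metis cong_sym cong_trans mult.assoc mult.commute mult_1)
qed

lemma choose_prime_cong:
  assumes "k < p - 1"
  shows "[int (p choose Suc k) = int p * (- 1) ^ k * v (Suc k)] (mod int p ^ 2)"
  using cong_inverse[OF _ _ times_choose_prime_cong[OF prime_p], of k] assms
  by (simp add: mult.commute)

text \<open>The same Pascal recursion as modulo p, but now C(p, k + 1) is kept to first order and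
  contributes the next harmonic term.\<close>

lemma choose_pred_prime_cong_square:
  "k < p \<Longrightarrow> [int (p - 1 choose k) = (- 1) ^ k * (1 - int p * (\<Sum>j = 1..k. v j))] (mod int p ^ 2)"
proof (induction k)
  case 0
  show ?case by simp
next
  case (Suc k)
  have "p = Suc (p - 1)" using prime_gt_0_nat[OF prime_p] by simp
  then have "int (p - 1 choose Suc k) = int (p choose Suc k) - int (p - 1 choose k)"
    by (metis add_diff_cancel_left' binomial_Suc_Suc of_nat_add)
  also have "[\<dots> =
      int p * (- 1) ^ k * v (Suc k) - (- 1) ^ k * (1 - int p * (\<Sum>j = 1..k. v j))] (mod int p ^ 2)"
    using Suc choose_prime_cong[of k] by (intro cong_diff) auto
  also have "int p * (- 1) ^ k * v (Suc k) - (- 1) ^ k * (1 - int p * (\<Sum>j = 1..k. v j)) =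
      (- 1) ^ Suc k * (1 - int p * (\<Sum>j = 1..Suc k. v j))"
    by (simp add: algebra_simps)
  finally show ?case .
qed

text \<open>The binomial is the product of 1 + p / j over j = 1..i, expanded to first order in
  p.\<close>

lemma choose_prime_add_cong:
  "i < p \<Longrightarrow> [int (p + i choose i) = 1 + int p * (\<Sum>j = 1..i. v j)] (mod int p ^ 2)"
proof (induction i)
  case 0
  show ?case by simp
next
  case (Suc i)
  let ?h = "\<Sum>j = 1..i. v j"
  have "Suc i * (p + Suc i choose Suc i) = (p + Suc i) * (p + i choose i)"
    using Suc_times_binomial[of i "p + i"] by simp
  then have "int (Suc i) * int (p + Suc i choose Suc i) = (int p + int (Suc i)) * int (p + i choose i)"
    by (metis of_nat_add of_nat_mult)
  also have "[\<dots> = (int p + int (Suc i)) * (1 + int p * ?h)] (mod int p ^ 2)"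
    using Suc by (intro cong_scalar_left) auto
  finally have "[int (p + Suc i choose Suc i) = v (Suc i) * ((int p + int (Suc i)) * (1 + int p * ?h))] (mod int p ^ 2)"
    using Suc.prems by (intro cong_inverse) auto
  also have "v (Suc i) * ((int p + int (Suc i)) * (1 + int p * ?h)) =
      int p * v (Suc i) + (int (Suc i) * v (Suc i)) * (1 + int p * ?h) + int p ^ 2 * (v (Suc i) * ?h)"
    by (simp add: algebra_simps power2_eq_square)
  also have "[\<dots> = int p * v (Suc i) + 1 * (1 + int p * ?h) + 0] (mod int p ^ 2)"
    using inverse[of "Suc i"] Suc.prems
    by (intro cong_add cong_scalar_right cong_refl) (auto simp: cong_0_iff)
  finally show ?case by (simp add: algebra_simps)
qed

text \<open>Eisenstein's congruence 2 q_p(2) = -H modulo p in disguise, because 4^m = 1 + p q_p(2).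
  The even-indexed entries of row p sum to 4^m, and 2 C(p, 2j) is -p / j modulo p^2.\<close>

lemma two_times_four_power_cong:
  "[2 * 4 ^ m = 2 - int p * (\<Sum>j = 1..m. v j)] (mod int p ^ 2)"
proof -
  have "2 * (\<Sum>i\<le>p. if even i then int (p choose i) else 0) = 2 ^ p"
    using choose_even_sum[of p, where ?'a = int] prime_gt_0_nat[OF prime_p] by simp
  then have "(\<Sum>i\<le>p. if even i then int (p choose i) else 0) = 4 ^ m"
    by (simp add: p_eq power_mult)
  moreover have "(\<Sum>i\<le>p. if even i then int (p choose i) else 0) = (\<Sum>j = 0..m. int (p choose (2 * j)))"
  proof -
    have "(\<Sum>i\<le>p. if even i then int (p choose i) else 0) = (\<Sum>i | i \<le> p \<and> even i. int (p choose i))"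
      by (rule sum.mono_neutral_cong_right) auto
    also have "\<dots> = (\<Sum>j = 0..m. int (p choose (2 * j)))"
      by (rule sum.reindex_bij_witness[of _ "\<lambda>j. 2 * j" "\<lambda>i. i div 2"]) (auto simp: p_eq)
    finally show ?thesis .
  qed
  ultimately have "2 * 4 ^ m = (\<Sum>j = 0..m. 2 * int (p choose (2 * j)))"
    by (simp flip: sum_distrib_left)
  also have "\<dots> = 2 + (\<Sum>j = 1..m. 2 * int (p choose (2 * j)))"
    by (simp add: sum.atLeast_Suc_atMost)
  also have "[\<dots> = 2 + (\<Sum>j = 1..m. - int p * v j)] (mod int p ^ 2)"
  proof (intro cong_add cong_refl cong_sum)
    fix j assume j: "j \<in> {1..m}"
    \<comment> \<open>The lower index 2j is the successor of an odd number, which fixes the sign as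
      -1. The factor 2 then moves to the binomial, leaving the inverse of j instead of 2j.\<close>
    have "Suc (2 * j - 1) = 2 * j" "odd (2 * j - 1)" using j by auto
    then have "[int (2 * j) * int (p choose (2 * j)) = int p * - 1] (mod int p ^ 2)"
      using times_choose_prime_cong[OF prime_p, of "2 * j - 1"] j by (simp add: p_eq)
    then have "[int j * (2 * int (p choose (2 * j))) = - int p] (mod int p ^ 2)"
      by (simp add: ac_simps)
    then have "[2 * int (p choose (2 * j)) = v j * (- int p)] (mod int p ^ 2)"
      using j by (intro cong_inverse) (auto simp: p_eq)
    then show "[2 * int (p choose (2 * j)) = - int p * v j] (mod int p ^ 2)"
      by (simp add: mult.commute)
  qed
  finally show ?thesis by (simp add: sum_distrib_left sum_negf)
qed

text \<open>Fermat's little theorem for base 2, read off from the previous congruence.\<close>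

lemma four_power_cong: "[4 ^ m = 1] (mod int p)"
proof -
  have "int p dvd 2 * 4 ^ m - (2 - int p * (\<Sum>j = 1..m. v j))"
    using two_times_four_power_cong unfolding cong_iff_dvd_diff
    by (metis dvd_trans dvd_triv_left power2_eq_square)
  then have "int p dvd 2 * (4 ^ m - 1) + int p * (\<Sum>j = 1..m. v j)"
    by (simp add: algebra_simps)
  then have "int p dvd 2 * (4 ^ m - 1)"
    by (simp add: dvd_add_left_iff)
  moreover have "coprime (int p) 2" by (simp add: p_eq)
  ultimately have "int p dvd 4 ^ m - 1"
    using coprime_dvd_mult_right_iff by blast
  then show ?thesis by (simp add: cong_iff_dvd_diff)
qed

section \<open>The dual sum modulo p^2\<close>

lemma dual_term_cong:
  assumes "i < m"
  shows "[int (2 * m choose m) * (int (2 * i choose i) * 4 ^ (m - i) * int (p + i choose m))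
    = - int p * v (m - i)] (mod int p ^ 2)"
proof -
  have pred: "Suc (m - i - 1) = m - i" "m - i - 1 < p - 1" "p - 1 = 2 * m"
    and sign: "odd (m + i + (m - i - 1))"
    using assms p_eq by auto
  \<comment> \<open>This exchange exposes the factor p: as 0 < m - i < p, it divides C(p, m - i),
    and it does not divide C(m, i), so it divides C(p + i, m).\<close>
  have split: "(p + i choose m) * (m choose i) = (p + i choose i) * (p choose (m - i))"
    using choose_mult[of i m "p + i"] assms p_eq by simp
  have dvd_p: "p dvd (p choose (m - i))"
    by (rule dvd_choose_prime) (use assms p_eq prime_p in auto)
  then have "p dvd (p + i choose i) * (p choose (m - i))" by simp
  then have "p dvd (p + i choose m)"
    using prime_not_dvd_choose[OF prime_p, of m i] prime_dvd_mult_iff[OF prime_p] assms p_eq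
    unfolding split[symmetric] by auto
  then have dvd: "int p dvd int (p + i choose m)" by simp
  \<comment> \<open>By \<open>dvd\<close>, the cofactor of C(p + i, m) is needed only modulo p. It
    reduces to a sign times C(m, i), exactly the factor that \<open>split\<close> requires.\<close>
  have "[int (p - 1 choose m) * (int (2 * i choose i) * 4 ^ (m - i)) =
      (- 1) ^ m * ((- 4) ^ i * int (m choose i) * 4 ^ (m - i))] (mod int p)"
    using assms prime_p p_eq
    by (intro cong_mult choose_pred_prime_cong central_binomial_cong cong_refl) auto
  also have "(- 1) ^ m * ((- 4) ^ i * int (m choose i) * 4 ^ (m - i)) =
      4 ^ m * ((- 1) ^ (m + i) * int (m choose i))"
  proof -
    have "(4::int) ^ m = 4 ^ i * 4 ^ (m - i)" using assms by (simp flip: power_add)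
    moreover have "(- 4 :: int) ^ i = (- 1) ^ i * 4 ^ i" by (simp flip: power_mult_distrib)
    ultimately show ?thesis by (simp add: power_add)
  qed
  also have "[\<dots> = 1 * ((- 1) ^ (m + i) * int (m choose i))] (mod int p)"
    using four_power_cong by (rule cong_scalar_right)
  finally have "[int (p - 1 choose m) * (int (2 * i choose i) * 4 ^ (m - i)) * int (p + i choose m) =
      (- 1) ^ (m + i) * int (m choose i) * int (p + i choose m)] (mod int p ^ 2)"
    using dvd by (intro cong_mult_square_modulus) auto
  also have "(- 1) ^ (m + i) * int (m choose i) * int (p + i choose m) =
      (- 1) ^ (m + i) * (int (p + i choose i) * int (p choose (m - i)))"
    using arg_cong[OF split, of int]
    by (simp only: of_nat_mult mult.assoc mult.commute[of "int (m choose i)"])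
  \<comment> \<open>C(p, m - i) already carries a factor p, so C(p + i, i) may be replaced by its
    residue 1 modulo p.\<close>
  also have "[\<dots> = (- 1) ^ (m + i) * (1 * int (p choose (m - i)))] (mod int p ^ 2)"
  proof (intro cong_scalar_left cong_mult_square_modulus)
    have "i < p" using assms p_eq by simp
    then have "[int (p + i choose i) = 1 + int p * (\<Sum>j = 1..i. v j)] (mod int p)"
      by (rule cong_dvd_modulus[OF choose_prime_add_cong]) simp
    also have "[1 + int p * (\<Sum>j = 1..i. v j) = 1] (mod int p)"
      by (simp add: cong_iff_dvd_diff)
    finally show "[int (p + i choose i) = 1] (mod int p)" .
    show "int p dvd int (p choose (m - i))"
      using dvd_p by (simp only: int_dvd_int_iff)
  qed
  also have "[(- 1) ^ (m + i) * (1 * int (p choose (m - i))) =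
      (- 1) ^ (m + i) * (1 * (int p * (- 1) ^ (m - i - 1) * v (m - i)))] (mod int p ^ 2)"
    using choose_prime_cong[OF pred(2)] unfolding pred(1) by (intro cong_scalar_left)
  also have "(- 1) ^ (m + i) * (1 * (int p * (- 1) ^ (m - i - 1) * v (m - i))) =
      (- 1) ^ (m + i + (m - i - 1)) * (int p * v (m - i))"
    by (simp add: power_add)
  \<comment> \<open>The total exponent of -1 is 2m - 1.\<close>
  also have "\<dots> = - int p * v (m - i)"
    using sign by simp
  finally show ?thesis by (simp only: pred(3) mult.assoc)
qed

text \<open>The terms with i < m add up to -pH, and the term i = m is (1 - pH)^2 (1 + pH), which is
  1 - pH. The total 1 - 2pH matches 256^m = (4^m)^4, since 4^m is 1 - pH/2.\<close>

lemma dual_sum_cong: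
  "[int (2 * m choose m) * (\<Sum>i = 0..m. int (2 * i choose i) * 4 ^ (m - i) * int (p + i choose m))
    = 256 ^ m] (mod int p ^ 2)"
proof -
  define P where "P = int p"
  define h where "h = (\<Sum>j = 1..m. v j)"
  define c where "c = int (2 * m choose m)"
  have c: "[c = (- 1) ^ m * (1 - P * h)] (mod P ^ 2)"
    using choose_pred_prime_cong_square[of m] by (simp add: p_eq P_def c_def h_def)
  have "[c * (c * int (p + m choose m)) =
     ((- 1) ^ m * (1 - P * h)) * (((- 1) ^ m * (1 - P * h)) * (1 + P * h))] (mod P ^ 2)"
    using c choose_prime_add_cong[of m] by (intro cong_mult) (auto simp: P_def h_def p_eq)
  also have "((- 1) ^ m * (1 - P * h)) * (((- 1) ^ m * (1 - P * h)) * (1 + P * h)) =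
      (1 - P * h) * ((1 - P * h) * (1 + P * h))"
    by (simp add: algebra_simps flip: power_add mult_2)
  also have "\<dots> = 1 - P * h + P ^ 2 * (P * h ^ 3 - h ^ 2)"
    by algebra
  finally have last: "[c * (c * int (p + m choose m)) = 1 - P * h] (mod P ^ 2)"
    by (simp add: cong_def)
  have "(\<Sum>i = 0..<m. v (m - i)) = h"
    unfolding h_def
    by (rule sum.reindex_bij_witness[of _ "\<lambda>j. m - j" "\<lambda>i. m - i"]) auto
  then have rest_eq: "(\<Sum>i = 0..<m. - P * v (m - i)) = - P * h"
    by (simp only: sum_distrib_left[symmetric])
  have rest: "[(\<Sum>i = 0..<m. c * (int (2 * i choose i) * 4 ^ (m - i) * int (p + i choose m))) =
      (\<Sum>i = 0..<m. - P * v (m - i))] (mod P ^ 2)"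
    using dual_term_cong by (intro cong_sum) (auto simp: P_def c_def)
  have "c * (\<Sum>i = 0..m. int (2 * i choose i) * 4 ^ (m - i) * int (p + i choose m)) =
      (\<Sum>i = 0..<m. c * (int (2 * i choose i) * 4 ^ (m - i) * int (p + i choose m)))
      + c * (c * int (p + m choose m))"
    by (simp add: c_def sum_distrib_left distrib_left flip: atLeastLessThanSuc_atLeastAtMost)
  also have "[\<dots> = - P * h + (1 - P * h)] (mod P ^ 2)"
    using cong_add[OF rest last] unfolding rest_eq .
  \<comment> \<open>The factor 16 avoids halves: (2 - P h)^4 has first-order part 16 (1 - 2 P h),
    and (2 * 4^m)^4 = 16 * 256^m. It is cancelled at the end because p is odd.\<close>
  finally have "[16 * (c * (\<Sum>i = 0..m. int (2 * i choose i) * 4 ^ (m - i) * int (p + i choose m))) =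
      16 * (- P * h + (1 - P * h))] (mod P ^ 2)"
    by (rule cong_scalar_left)
  also have "[16 * (- P * h + (1 - P * h)) = (2 - P * h) ^ 4] (mod P ^ 2)"
  proof -
    have "(2 - P * h) ^ 4 = 16 * (- P * h + (1 - P * h)) + P ^ 2 * (24 * h ^ 2 - 8 * P * h ^ 3 + P ^ 2 * h ^ 4)"
      by algebra
    then show ?thesis by (simp add: cong_def)
  qed
  also have "[(2 - P * h) ^ 4 = (2 * 4 ^ m) ^ 4] (mod P ^ 2)"
    using two_times_four_power_cong unfolding P_def h_def by (intro cong_pow) (rule cong_sym)
  also have "(2 * 4 ^ m) ^ 4 = (16 * 256 ^ m :: int)"
    by (simp add: power_mult_distrib flip: power_mult) (simp add: mult.commute[of m] power_mult)
  finally have "[16 * (c * (\<Sum>i = 0..m. int (2 * i choose i) * 4 ^ (m - i) * int (p + i choose m))) =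
      16 * 256 ^ m] (mod P ^ 2)" .
  moreover have "coprime 2 P" by (simp add: P_def p_eq)
  then have "coprime (2 ^ 4) (P ^ 2)"
    by (simp only: coprime_power_left_iff coprime_power_right_iff simp_thms)
  then have "coprime 16 (P ^ 2)" by simp
  ultimately show ?thesis
    unfolding c_def P_def by (simp only: cong_mult_lcancel)
qed

end

section \<open>Return to p-integral rationals\<close>

lemma prime_square_inverses_exist:
  assumes "prime p" "p = 2 * m + 1"
  shows "\<exists>v. prime_square_inverses p m v"
proof -
  have "\<exists>x. [int j * x = 1] (mod int p ^ 2)" if "0 < j" "j < p" for j
  proof (rule cong_solve_coprime_int)
    show "coprime (int j) (int p ^ 2)"
      using that assms(1) prime_imp_coprime[of p j] nat_dvd_not_less[of j p]
      by (simp add: coprime_commute)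
  qed
  then obtain v where "\<forall>j. 0 < j \<and> j < p \<longrightarrow> [int j * v j = 1] (mod int p ^ 2)"
    by metis
  with assms have "prime_square_inverses p m v" by unfold_locales auto
  then show ?thesis by blast
qed

text \<open>Cross-multiplying with the reduced fraction n / d gives n b = a d, and d is coprime to
  n. Any explicit denominator prime to p therefore certifies p-integrality.\<close>

lemma denominator_dvd:
  assumes "b \<noteq> 0"
  shows "snd (quotient_of (of_int a / of_int b)) dvd b"
proof -
  obtain n d where nd: "quotient_of (of_int a / of_int b) = (n, d)" by fastforce
  have d: "d > 0" "coprime n d"
    using quotient_of_denom_pos[OF nd] quotient_of_coprime[OF nd] by auto
  have "(of_int a / of_int b :: rat) = of_int n / of_int d"
    using quotient_of_div[OF nd] .
  then have "(of_int (a * d) :: rat) = of_int (n * b)"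
    using assms d by (simp add: field_simps)
  then have "n * b = a * d" by (simp only: of_int_eq_iff)
  then have "d dvd n * b" by simp
  then have "d dvd b" using d by (simp add: coprime_commute coprime_dvd_mult_right_iff)
  then show ?thesis by (simp add: nd)
qed

theorem theorem1p4:
  fixes p :: nat
  assumes "prime p" and "p > 2"
  shows "rat_cong_pow
           (\<Sum>k = 0..(p - 1) div 2.
              (11 * of_nat k + 3) / 64 ^ k * of_nat ((2 * k choose k) ^ 2 * (3 * k choose k)))
           (3 * of_nat p + 3 * of_nat p ^ 2 * fermat_quotient2 p) p 3"
proof -
  have "odd p" using assms prime_odd_nat by auto
  then obtain m where m: "p = 2 * m + 1" by (rule oddE)
  then have half: "(p - 1) div 2 = m" by simp
  obtain v where "prime_square_inverses p m v"
    using prime_square_inverses_exist[OF assms(1) m] by blast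
  then interpret prime_square_inverses p m v .
  \<comment> \<open>Multiplying by 4^m clears the denominators 4^i, so \<open>X\<close> is an
    integer; the dual sum is then 3p X / 64^m.\<close>
  define X where "X = int (2 * m choose m) *
      (\<Sum>i = 0..m. int (2 * i choose i) * 4 ^ (m - i) * int (p + i choose m))"
  have "int p ^ 2 dvd X - 256 ^ m"
    using dual_sum_cong unfolding X_def cong_iff_dvd_diff .
  then obtain y where "X - 256 ^ m = int p ^ 2 * y" by (rule dvdE)
  then have "X = 256 ^ m + int p ^ 2 * y" by simp
  then have y: "(of_int X :: rat) = 256 ^ m + of_nat p ^ 2 * of_int y" by simp
  have "dual_summand m i = 3 * of_nat p / 64 ^ m *
      (of_nat (2 * m choose m) * (of_nat (2 * i choose i) * 4 ^ (m - i) * of_nat (p + i choose m)))"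
    if "i \<le> m" for i
  proof -
    have "(64::rat) ^ m = 16 ^ m * (4 ^ i * 4 ^ (m - i))"
      using that by (simp flip: power_add power_mult_distrib)
    then show ?thesis
      by (simp add: dual_summand_def m)
  qed
  then have "(\<Sum>k = 0..m. summand k) = 3 * of_nat p / 64 ^ m * of_int X"
    unfolding sum_summand X_def by (simp add: sum_distrib_left)
  moreover have "3 * of_nat p + 3 * of_nat p ^ 2 * fermat_quotient2 p = 3 * of_nat p * 4 ^ m"
  proof -
    have "(2::rat) ^ (p - 1) = 4 ^ m" by (simp add: m power_mult)
    moreover have "(of_nat p :: rat) \<noteq> 0" using assms by simp
    moreover have "3 * P + 3 * P ^ 2 * ((Q - 1) / P) = 3 * P * Q" if "P \<noteq> 0" for P Q :: rat
      using that by (simp add: field_simps power2_eq_square)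
    ultimately show ?thesis by (simp only: fermat_quotient2_def)
  qed
  \<comment> \<open>Here 256^m / 64^m = 4^m gives the main term, and the prefactor 3p raises the
    error from p^2 to p^3.\<close>
  moreover have "3 * P / 64 ^ m * (256 ^ m + P ^ 2 * Y) - 3 * P * 4 ^ m = P ^ 3 * (3 * Y / 64 ^ m)"
    for P Y :: rat
  proof -
    have "(256::rat) ^ m = 4 ^ m * 64 ^ m" by (simp flip: power_mult_distrib)
    then show ?thesis by (simp add: field_simps power2_eq_square power3_eq_cube)
  qed
  ultimately have "((\<Sum>k = 0..m. summand k) - (3 * of_nat p + 3 * of_nat p ^ 2 * fermat_quotient2 p)) / of_nat p ^ 3
      = of_int (3 * y) / of_int (64 ^ m)"
    using assms by (simp add: y)
  moreover have "coprime (64 ^ m) (int p)"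
  proof -
    have "coprime 2 (int p)" using \<open>odd p\<close> by simp
    then have "coprime ((2 ^ 6) ^ m) (int p)"
      by (simp only: coprime_power_left_iff simp_thms)
    then show ?thesis by simp
  qed
  then have "coprime (snd (quotient_of (of_int (3 * y) / of_int (64 ^ m)))) (int p)"
    by (rule coprime_divisors[OF denominator_dvd dvd_refl, rotated]) simp
  ultimately show ?thesis
    unfolding rat_cong_pow_def half summand_def[symmetric] by (simp only:)
qed

end
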